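(* There exists a disconnected graph that is $3$-$\chi_{ig}^{A}$-game-vertex-critical, and there exists a disconnected graph that is $3$-$\chi_{ig}^{AB}$-game-vertex-critical.
   Context: All graphs are simple, undirected and finite. The independence coloring game on a graph $G$ is played by Alice and Bob in rounds, round $i$ being played with color $i$ ($i=1,2,\ldots$). Within a round the players alternate moves, each move consisting of coloring a previously uncolored vertex with the color of the round so that the vertices colored in the same round form an independent set. A round is completed when no uncolored vertex can be given the color of the round (every uncolored vertex is adjacent to a vertex colored in this round). The game is over when all vertices are colored. Alice wants to finish in as few rounds as possible, Bob in as many rounds as possible. In the A-independence coloring game every round is started by Alice; the number of rounds when both players play optimally is the A-independence game chromatic number $\chi_{ig}^{A}(G)$. In the AB-independence coloring game Alice starts the first round and each further round is started by the player who did not make the last move of the previous round; the number of rounds when both players play optimally is the AB-independence game chromatic number $\chi_{ig}^{AB}(G)$. For $x\in V(G)$, $G-x$ is the graph obtained from $G$ by deleting $x$ and all edges incident with $x$. For $\varphi\in\{\chi_{ig}^{A},\chi_{ig}^{AB}\}$, a graph $G$ is $k$-$\varphi$-game-vertex-critical if $\varphi(G)=k$ and $\varphi(G-x)\neq\varphi(G)$ for every $x\in V(G)$. *)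

theory Defs
  imports "Graph_Theory.Graph_Theory"
begin

text \<open>
  Simple undirected finite graphs are those satisfying \<^locale>\<open>graph\<close>, i.e. finite, loopfree,
  symmetric digraphs without parallel arcs; each edge is the pair of its two orientations.
\<close>

datatype player = Alice | Bob

fun opponent :: "player \<Rightarrow> player" where
  "opponent Alice = Bob"
| "opponent Bob = Alice"

text \<open>
  In a position, \<open>U\<close> is the set of uncolored vertices and \<open>C\<close> the set of vertices that
  already carry the color of the current round. Earlier color classes do not affect the rest
  of the game.
\<close>

definition legal_moves :: "('a, 'b) pre_digraph \<Rightarrow> 'a set \<Rightarrow> 'a set \<Rightarrow> 'a set" where
  "legal_moves G U C = {v \<in> U. \<forall>w \<in> C. \<not> v \<rightarrow>\<^bsub>G\<^esub> w}"

text \<open>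
  A starting rule maps the player whose turn it would be when a round is completed, that is
  the player who did not make the last move of that round, to the player who starts the next
  round.
\<close>

type_synonym starting_rule = "player \<Rightarrow> player"

definition rule_A :: starting_rule where
  "rule_A p = Alice"

definition rule_AB :: starting_rule where
  "rule_AB p = p"

text \<open>
  The minimax value, with player \<open>p\<close> to move, of the number of rounds still to be started
  after the current one. For infinite \<open>U\<close> the value 0 is a dummy that makes the recursion total.
\<close>

function further_rounds ::
  "('a, 'b) pre_digraph \<Rightarrow> starting_rule \<Rightarrow> player \<Rightarrow> 'a set \<Rightarrow> 'a set \<Rightarrow> nat" where
  "further_rounds G r p U C =
     (if infinite U \<or> U = {} then 0
      else if legal_moves G U C = {} then Suc (further_rounds G r (r p) U {})
      else if p = Alice
        then Min ((\<lambda>v. further_rounds G r (opponent p) (U - {v}) (insert v C)) ` legal_moves G U C)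
        else Max ((\<lambda>v. further_rounds G r (opponent p) (U - {v}) (insert v C)) ` legal_moves G U C))"
  by pat_completeness auto

termination
proof (relation "measures [\<lambda>(G, r, p, U, C). card U, \<lambda>(G, r, p, U, C). if C = {} then 0 else 1]",
    goal_cases)
  case 1
  show ?case by simp
next
  case (2 G r p U C)
  then show ?case by (auto simp: legal_moves_def)
next
  case (3 G r p U C v)
  then have "v \<in> U" "0 < card U" by (auto simp: legal_moves_def card_gt_0_iff)
  then show ?case by simp
next
  case (4 G r p U C v)
  then have "v \<in> U" "0 < card U" by (auto simp: legal_moves_def card_gt_0_iff)
  then show ?case by simp
qed

declare further_rounds.simps [simp del]

definition game_chromatic_number :: "starting_rule \<Rightarrow> ('a, 'b) pre_digraph \<Rightarrow> nat" where
  "game_chromatic_number r G =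
     (if verts G = {} then 0 else Suc (further_rounds G r Alice (verts G) {}))"

definition chi_ig_A :: "('a, 'b) pre_digraph \<Rightarrow> nat" where
  "chi_ig_A = game_chromatic_number rule_A"

definition chi_ig_AB :: "('a, 'b) pre_digraph \<Rightarrow> nat" where
  "chi_ig_AB = game_chromatic_number rule_AB"

definition game_vertex_critical ::
  "nat \<Rightarrow> (('a, 'b) pre_digraph \<Rightarrow> nat) \<Rightarrow> ('a, 'b) pre_digraph \<Rightarrow> bool" where
  "game_vertex_critical k \<phi> G \<longleftrightarrow>
     \<phi> G = k \<and> (\<forall>x \<in> verts G. \<phi> (pre_digraph.del_vert G x) \<noteq> \<phi> G)"

end

theory Submission
  imports Defs
begin

text \<open>
  The witness for both starting rules is the disjoint union of a hexagon and two isolated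
  vertices. Three rounds always suffice, since a vertex left uncolored by a round loses a
  neighbor to it and all degrees are at most 2. Two rounds suffice iff the first color class
  has an independent complement. In the whole graph Bob prevents this by letting two opposite
  vertices of the hexagon enter the first class: he answers a move on the hexagon by the
  opposite vertex, and an isolated vertex by the other one. After deleting a hexagon vertex,
  Alice starts with the vertex opposite to it; after deleting an isolated vertex, she takes
  the other one, so that Bob has to open the hexagon and she can play at distance 2 from his
  vertex.
\<close>

lemma finite_legal_moves: "finite U \<Longrightarrow> finite (legal_moves G U C)"
  by (simp add: legal_moves_def)

lemma legal_moves_subset: "legal_moves G U C \<subseteq> U"
  by (auto simp: legal_moves_def)

section \<open>Bounding the number of rounds by single moves\<close>

lemma further_rounds_complete:
  assumes "finite U" "U \<noteq> {}" "legal_moves G U C = {}"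
  shows "further_rounds G r p U C = Suc (further_rounds G r (r p) U {})"
  using assms by (subst further_rounds.simps) simp

lemma further_rounds_Alice:
  assumes "finite U" "legal_moves G U C \<noteq> {}"
  shows "further_rounds G r Alice U C =
    Min ((\<lambda>v. further_rounds G r Bob (U - {v}) (insert v C)) ` legal_moves G U C)"
  using assms legal_moves_subset[of G U C] by (subst further_rounds.simps) auto

lemma further_rounds_Bob:
  assumes "finite U" "legal_moves G U C \<noteq> {}"
  shows "further_rounds G r Bob U C =
    Max ((\<lambda>v. further_rounds G r Alice (U - {v}) (insert v C)) ` legal_moves G U C)"
  using assms legal_moves_subset[of G U C] by (subst further_rounds.simps) auto

lemma further_rounds_Alice_le:
  assumes "finite U" "v \<in> legal_moves G U C"
    "further_rounds G r Bob (U - {v}) (insert v C) \<le> k"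
  shows "further_rounds G r Alice U C \<le> k"
proof -
  have "Min ((\<lambda>v. further_rounds G r Bob (U - {v}) (insert v C)) ` legal_moves G U C)
      \<le> further_rounds G r Bob (U - {v}) (insert v C)"
    using assms by (intro Min_le) (auto simp: finite_legal_moves)
  then show ?thesis
    using assms by (subst further_rounds_Alice) auto
qed

lemma further_rounds_Bob_ge:
  assumes "finite U" "v \<in> legal_moves G U C"
    "k \<le> further_rounds G r Alice (U - {v}) (insert v C)"
  shows "k \<le> further_rounds G r Bob U C"
proof -
  have "further_rounds G r Alice (U - {v}) (insert v C)
      \<le> Max ((\<lambda>v. further_rounds G r Alice (U - {v}) (insert v C)) ` legal_moves G U C)"
    using assms by (intro Max_ge) (auto simp: finite_legal_moves)
  then show ?thesis
    using assms by (subst further_rounds_Bob) auto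
qed

lemma further_rounds_le:
  assumes "finite U" "legal_moves G U C \<noteq> {}"
    "\<And>v. v \<in> legal_moves G U C \<Longrightarrow>
      further_rounds G r (opponent p) (U - {v}) (insert v C) \<le> k"
  shows "further_rounds G r p U C \<le> k"
proof (cases p)
  case Alice
  then show ?thesis
    using assms further_rounds_Alice_le[of U _ G C r k] by auto
next
  case Bob
  then show ?thesis
    using assms by (auto simp: further_rounds_Bob finite_legal_moves)
qed

lemma further_rounds_ge:
  assumes "finite U" "legal_moves G U C \<noteq> {}"
    "\<And>v. v \<in> legal_moves G U C \<Longrightarrow>
      k \<le> further_rounds G r (opponent p) (U - {v}) (insert v C)"
  shows "k \<le> further_rounds G r p U C"
proof (cases p)
  case Alice
  then show ?thesis
    using assms by (auto simp: further_rounds_Alice finite_legal_moves)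
next
  case Bob
  then show ?thesis
    using assms further_rounds_Bob_ge[of U _ G C k r] by auto
qed

section \<open>Bounding the number of rounds by the position\<close>

text \<open>Each vertex left uncolored by a completed round loses a neighbor to that color class, so
  the degree bound drops by at least one per round. Counting neighbors in
  \<open>U \<union> C\<close> keeps the bound constant during a round.\<close>

lemma further_rounds_le_degree:
  assumes "\<And>v. v \<in> U \<Longrightarrow> card {w \<in> U \<union> C. v \<rightarrow>\<^bsub>G\<^esub> w} \<le> d"
    and "finite C" "U \<inter> C = {}"
  shows "further_rounds G r p U C \<le> d"
  using assms
proof (induction G r p U C arbitrary: d rule: further_rounds.induct)
  case (1 G r p U C)
  show ?case
  proof (cases "infinite U \<or> U = {}")
    case True
    then show ?thesis by (subst further_rounds.simps) simp
  next
    case fin: False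
    show ?thesis
    proof (cases "legal_moves G U C = {}")
      case True
      have less: "card {w \<in> U. v \<rightarrow>\<^bsub>G\<^esub> w} < d" if "v \<in> U" for v
      proof -
        from True that obtain c where "c \<in> C" "v \<rightarrow>\<^bsub>G\<^esub> c"
          by (auto simp: legal_moves_def)
        then have "{w \<in> U. v \<rightarrow>\<^bsub>G\<^esub> w} \<subset> {w \<in> U \<union> C. v \<rightarrow>\<^bsub>G\<^esub> w}"
          using "1.prems"(3) by blast
        then have "card {w \<in> U. v \<rightarrow>\<^bsub>G\<^esub> w} < card {w \<in> U \<union> C. v \<rightarrow>\<^bsub>G\<^esub> w}"
          using fin "1.prems"(2) by (intro psubset_card_mono) auto
        then show ?thesis using "1.prems"(1)[OF that] by simp
      qed
      \<comment> \<open>Positivity makes the truncated \<open>d - 1\<close> a true predecessor, so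
        that \<open>Suc (d - 1) = d\<close>.\<close>
      then have "0 < d" using fin by fastforce
      have "further_rounds G r (r p) U {} \<le> d - 1"
        using less by (intro "1.IH"(1) fin True) fastforce+
      then show ?thesis
        using \<open>0 < d\<close> fin True by (simp add: further_rounds_complete)
    next
      case False
      have "further_rounds G r (opponent p) (U - {v}) (insert v C) \<le> d"
        if v: "v \<in> legal_moves G U C" for v
      proof -
        \<comment> \<open>A move only transfers \<open>v\<close> from \<open>U\<close> to
          \<open>C\<close>, so all counted degrees stay the same.\<close>
        have eq: "(U - {v}) \<union> insert v C = U \<union> C"
          using v by (auto simp: legal_moves_def)
        have "card {w \<in> (U - {v}) \<union> insert v C. u \<rightarrow>\<^bsub>G\<^esub> w} \<le> d" if "u \<in> U - {v}" for u
          unfolding eq using "1.prems"(1) that by blast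
        moreover have "finite (insert v C)" "(U - {v}) \<inter> insert v C = {}"
          using "1.prems" by auto
        ultimately show ?thesis
          using "1.IH"(2)[OF fin False _ v, of d] "1.IH"(3)[OF fin False _ v, of d]
          by (cases "p = Alice") blast+
      qed
      then show ?thesis
        using fin False by (intro further_rounds_le[of U]) blast+
    qed
  qed
qed

lemma further_rounds_independent:
  assumes "finite U" "\<And>v w. v \<in> U \<Longrightarrow> w \<in> U \<Longrightarrow> \<not> v \<rightarrow>\<^bsub>G\<^esub> w"
  shows "further_rounds G r p U {} = 0"
proof -
  have "card {w \<in> U \<union> {}. v \<rightarrow>\<^bsub>G\<^esub> w} \<le> 0" if "v \<in> U" for v
    using assms(2)[OF that] by (auto simp: card_eq_0_iff)
  then have "further_rounds G r p U {} \<le> 0"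
    by (intro further_rounds_le_degree) auto
  then show ?thesis by simp
qed

text \<open>The outcome of the current round is forced here: independent legal vertices never block
  each other, so all of them get the color, whoever moves. The blocked vertices remain, and being
  independent they fit into one more round.\<close>

lemma further_rounds_le_one:
  assumes "finite U"
    and "\<And>v w. v \<in> legal_moves G U C \<Longrightarrow> w \<in> legal_moves G U C \<Longrightarrow> \<not> v \<rightarrow>\<^bsub>G\<^esub> w"
    and "\<And>v w. v \<in> U - legal_moves G U C \<Longrightarrow> w \<in> U - legal_moves G U C \<Longrightarrow> \<not> v \<rightarrow>\<^bsub>G\<^esub> w"
  shows "further_rounds G r p U C \<le> 1"
  using assms
proof (induction "card U" arbitrary: U C p)
  case 0
  then show ?case by (subst further_rounds.simps) simp
next
  case (Suc n)
  have ne: "U \<noteq> {}" using Suc.hyps(2) by auto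
  show ?case
  proof (cases "legal_moves G U C = {}")
    case True
    then have "further_rounds G r (r p) U {} = 0"
      using Suc.prems by (intro further_rounds_independent) auto
    then show ?thesis using ne True Suc.prems(1) by (simp add: further_rounds_complete)
  next
    case False
    show ?thesis
    proof (rule further_rounds_le[OF Suc.prems(1) False])
      fix v assume v: "v \<in> legal_moves G U C"
      then have vU: "v \<in> U" by (auto simp: legal_moves_def)
      have L: "legal_moves G (U - {v}) (insert v C) = legal_moves G U C - {v}"
        using Suc.prems(2)[OF _ v] by (auto simp: legal_moves_def)
      have D: "U - {v} - (legal_moves G U C - {v}) = U - legal_moves G U C"
        using v by auto
      show "further_rounds G r (opponent p) (U - {v}) (insert v C) \<le> 1"
      proof (rule Suc.hyps(1), unfold L D)
        show "n = card (U - {v})" using Suc.prems(1) Suc.hyps(2) vU by simp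
      qed (use Suc.prems in auto)
    qed
  qed
qed

text \<open>The ends of an edge cannot both get the current color. Allowing \<open>b\<close> to lie
  in \<open>C\<close> keeps the induction going after one end is colored.\<close>

lemma further_rounds_pos:
  assumes "finite U" "a \<in> U" "b \<in> U \<union> C" "a \<noteq> b" "a \<rightarrow>\<^bsub>G\<^esub> b" "b \<rightarrow>\<^bsub>G\<^esub> a"
  shows "1 \<le> further_rounds G r p U C"
  using assms
proof (induction "card U" arbitrary: U C p a b)
  case 0
  then show ?case by auto
next
  case (Suc n)
  show ?case
  proof (cases "legal_moves G U C = {}")
    case True
    then show ?thesis using Suc.prems by (subst further_rounds_complete) auto
  next
    case False
    show ?thesis
    proof (rule further_rounds_ge[OF Suc.prems(1) False])
      fix v assume v: "v \<in> legal_moves G U C"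
      then have card: "n = card (U - {v})"
        using Suc.prems(1) Suc.hyps(2) by (auto simp: legal_moves_def)
      show "1 \<le> further_rounds G r (opponent p) (U - {v}) (insert v C)"
      \<comment> \<open>If \<open>a\<close> is colored, its legality puts \<open>b\<close> in
        \<open>U\<close>, and the two ends exchange roles.\<close>
      proof (cases "v = a")
        case True
        then have "b \<in> U" using v Suc.prems by (auto simp: legal_moves_def)
        then show ?thesis
          using Suc.prems True by (intro Suc.hyps(1)[OF card, of b a]) auto
      next
        case False
        then show ?thesis
          using Suc.prems by (intro Suc.hyps(1)[OF card, of a b]) auto
      qed
    qed
  qed
qed

text \<open>Both ends of the edge \<open>a\<close>, \<open>b\<close> are blocked, by
  \<open>c\<close> and \<open>d\<close>, for the rest of this round. The edge thus survives into the
  next round, which cannot be the last one by \<open>further_rounds_pos\<close>.\<close>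

lemma further_rounds_ge_two:
  assumes "finite U" "a \<in> U" "b \<in> U" "a \<noteq> b" "a \<rightarrow>\<^bsub>G\<^esub> b" "b \<rightarrow>\<^bsub>G\<^esub> a"
    and "c \<in> C" "a \<rightarrow>\<^bsub>G\<^esub> c" "d \<in> C" "b \<rightarrow>\<^bsub>G\<^esub> d"
  shows "2 \<le> further_rounds G r p U C"
  using assms
proof (induction "card U" arbitrary: U C p)
  case 0
  then show ?case by auto
next
  case (Suc n)
  show ?case
  proof (cases "legal_moves G U C = {}")
    case True
    have "1 \<le> further_rounds G r (r p) U {}"
      using Suc.prems by (intro further_rounds_pos[of U a b]) auto
    then show ?thesis using True Suc.prems by (subst further_rounds_complete) auto
  next
    case False
    show ?thesis
    proof (rule further_rounds_ge[OF Suc.prems(1) False])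
      fix v assume v: "v \<in> legal_moves G U C"
      then have "v \<in> U" "v \<noteq> a" "v \<noteq> b"
        using Suc.prems by (auto simp: legal_moves_def)
      moreover from this have "n = card (U - {v})"
        using Suc.prems(1) Suc.hyps(2) by simp
      ultimately show "2 \<le> further_rounds G r (opponent p) (U - {v}) (insert v C)"
        using Suc.prems by (intro Suc.hyps(1)) auto
    qed
  qed
qed

section \<open>The hexagon with two isolated vertices\<close>

text \<open>Numbering the cycle by residues modulo 6 turns rotation into addition:
  \<open>(v + 3) mod 6\<close> is opposite to \<open>v\<close>. The vertices 6 and 7 are the
  isolated ones.\<close>

definition hexagon :: "(nat, nat \<times> nat) pre_digraph" where
  "hexagon = \<lparr>verts = {..<8},
     arcs = {(0,1), (1,2), (2,3), (3,4), (4,5), (5,0), (1,0), (2,1), (3,2), (4,3), (5,4), (0,5)},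
     tail = fst, head = snd\<rparr>"

lemma verts_hexagon: "verts hexagon = {0, 1, 2, 3, 4, 5, 6, 7}"
  by (auto simp: hexagon_def)

lemma arcs_ends_hexagon:
  "arcs_ends hexagon =
     {(0,1), (1,2), (2,3), (3,4), (4,5), (5,0), (1,0), (2,1), (3,2), (4,3), (5,4), (0,5)}"
  by (simp add: hexagon_def arcs_ends_conv)

lemma dominates_del_vert:
  "u \<rightarrow>\<^bsub>pre_digraph.del_vert G x\<^esub> v \<longleftrightarrow> u \<rightarrow>\<^bsub>G\<^esub> v \<and> u \<noteq> x \<and> v \<noteq> x"
  by (auto simp: arcs_ends_conv pre_digraph.del_vert_simps)

lemma graph_hexagon: "graph hexagon"
  by unfold_locales
    (auto simp: hexagon_def arc_to_ends_def symmetric_def sym_def arcs_ends_conv)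

text \<open>In a connected digraph with an arc, every vertex is an end of some arc, but 6 is
  not.\<close>

lemma not_connected_hexagon: "\<not> connected hexagon"
proof
  interpret graph hexagon by (rule graph_hexagon)
  assume "connected hexagon"
  then have "verts hexagon = tail hexagon ` arcs hexagon \<union> head hexagon ` arcs hexagon"
    by (intro connected_verts) (auto simp: hexagon_def)
  moreover have "6 \<in> verts hexagon" by (simp add: hexagon_def)
  ultimately show False by (auto simp: hexagon_def)
qed

lemma finite_verts_hexagon: "finite (verts hexagon)"
  by (simp add: verts_hexagon)

lemma degree_hexagon: "card {w. v \<rightarrow>\<^bsub>hexagon\<^esub> w} \<le> 2"
proof -
  \<comment> \<open>Successor and predecessor on the cycle, wrapping around at 5 and 0. For
    \<open>v\<close> off the cycle the left side is empty.\<close>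
  have "{w. v \<rightarrow>\<^bsub>hexagon\<^esub> w} \<subseteq> {if v = 5 then 0 else v + 1, if v = 0 then 5 else v - 1}"
    by (auto simp: arcs_ends_hexagon)
  from card_mono[OF _ this] show ?thesis
    by (simp add: card_insert_if split: if_splits)
qed

lemma game_chromatic_number_hexagon_le: "game_chromatic_number r hexagon \<le> 3"
proof -
  \<comment> \<open>The first round is not counted by \<open>further_rounds\<close>, so 2 stands for
    three rounds.\<close>
  have "further_rounds hexagon r Alice (verts hexagon) {} \<le> 2"
  proof (rule further_rounds_le_degree)
    fix v
    have "finite {w. v \<rightarrow>\<^bsub>hexagon\<^esub> w}"
      by (rule finite_subset[of _ "verts hexagon"]) (auto simp: verts_hexagon arcs_ends_hexagon)
    then have "card {w \<in> verts hexagon \<union> {}. v \<rightarrow>\<^bsub>hexagon\<^esub> w} \<le> card {w. v \<rightarrow>\<^bsub>hexagon\<^esub> w}"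
      by (intro card_mono) auto
    then show "card {w \<in> verts hexagon \<union> {}. v \<rightarrow>\<^bsub>hexagon\<^esub> w} \<le> 2"
      using degree_hexagon[of v] by simp
  qed auto
  then show ?thesis by (simp add: game_chromatic_number_def)
qed

text \<open>The two shapes of \<open>C\<close> are the positions where Bob strikes: exactly one
  cycle vertex is colored, and the isolated vertices are either both free or both used up.\<close>

lemma opposite_move_hexagon:
  assumes "v < 6" "C = {v} \<or> C = {v, 6, 7}"
  shows "2 \<le> further_rounds hexagon r Bob (verts hexagon - C) C"
proof -
  have v: "v \<in> {0, 1, 2, 3, 4, 5}" using assms(1) by auto
  have "finite (verts hexagon - C)"
    using finite_verts_hexagon by simp
  moreover have "(v + 3) mod 6 \<in> legal_moves hexagon (verts hexagon - C) C"
    using assms(2) v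
    by (elim insertE emptyE disjE) (simp_all add: legal_moves_def verts_hexagon arcs_ends_hexagon)
  moreover have "2 \<le> further_rounds hexagon r Alice
      (verts hexagon - C - {(v + 3) mod 6}) (insert ((v + 3) mod 6) C)"
  \<comment> \<open>One of the two arcs between the opposite vertices consists of two adjacent
    vertices, each blocked by the colored vertex next to it.\<close>
  proof (rule further_rounds_ge_two[of _ "(v + 1) mod 6" "(v + 2) mod 6" _ v _ "(v + 3) mod 6"])
    show "(v + 1) mod 6 \<in> verts hexagon - C - {(v + 3) mod 6}"
      "(v + 2) mod 6 \<in> verts hexagon - C - {(v + 3) mod 6}"
      using assms(2) v
      by (elim insertE emptyE disjE; simp add: verts_hexagon)+
    show "(v + 1) mod 6 \<noteq> (v + 2) mod 6"
      "((v + 1) mod 6) \<rightarrow>\<^bsub>hexagon\<^esub> ((v + 2) mod 6)" "((v + 2) mod 6) \<rightarrow>\<^bsub>hexagon\<^esub> ((v + 1) mod 6)"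
      "((v + 1) mod 6) \<rightarrow>\<^bsub>hexagon\<^esub> v" "((v + 2) mod 6) \<rightarrow>\<^bsub>hexagon\<^esub> ((v + 3) mod 6)"
      using v by (elim insertE emptyE; simp add: arcs_ends_hexagon)+
    show "v \<in> insert ((v + 3) mod 6) C"
      using assms(2) by auto
  qed (use finite_verts_hexagon in simp_all)
  ultimately show ?thesis
    by (rule further_rounds_Bob_ge)
qed

lemma game_chromatic_number_hexagon_ge: "3 \<le> game_chromatic_number r hexagon"
proof -
  have "2 \<le> further_rounds hexagon r Alice (verts hexagon) {}"
  proof (rule further_rounds_ge)
    fix v assume "v \<in> legal_moves hexagon (verts hexagon) {}"
    then have v: "v \<in> verts hexagon" by (simp add: legal_moves_def)
    show "2 \<le> further_rounds hexagon r (opponent Alice) (verts hexagon - {v}) (insert v {})"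
    proof (cases "v < 6")
      case True
      then show ?thesis using opposite_move_hexagon[of v "{v}"] by simp
    next
      case False
      with v obtain u :: nat where v67: "v = 6 \<and> u = 7 \<or> v = 7 \<and> u = 6"
        by (auto simp: verts_hexagon)
      \<comment> \<open>With both isolated vertices used up, Alice has to open the cycle at some
        \<open>w\<close>, and Bob again has the opposite reply.\<close>
      have "2 \<le> further_rounds hexagon r Alice (verts hexagon - {v} - {u}) {u, v}"
      proof (rule further_rounds_ge)
        have "0 \<in> legal_moves hexagon (verts hexagon - {v} - {u}) {u, v}"
          using v67
          by (elim disjE conjE) (simp_all add: legal_moves_def verts_hexagon arcs_ends_hexagon)
        then show "legal_moves hexagon (verts hexagon - {v} - {u}) {u, v} \<noteq> {}"
          by blast
      next
        fix w assume "w \<in> legal_moves hexagon (verts hexagon - {v} - {u}) {u, v}"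
        with v67 have "w < 6" by (auto simp: legal_moves_def verts_hexagon)
        moreover from v67 have "insert w {u, v} = {w, 6, 7}"
          "verts hexagon - {v} - {u} - {w} = verts hexagon - {w, 6, 7}"
          by auto
        ultimately show "2 \<le> further_rounds hexagon r (opponent Alice)
            (verts hexagon - {v} - {u} - {w}) (insert w {u, v})"
          using opposite_move_hexagon[of w "{w, 6, 7}"] by simp
      qed (use finite_verts_hexagon in simp)
      moreover have "u \<in> legal_moves hexagon (verts hexagon - {v}) {v}"
        using v67
        by (elim disjE conjE) (simp_all add: legal_moves_def verts_hexagon arcs_ends_hexagon)
      moreover have "finite (verts hexagon - {v})"
        using finite_verts_hexagon by simp
      ultimately show ?thesis
        unfolding opponent.simps by (intro further_rounds_Bob_ge[where v = u])
    qed
  qed (auto simp: legal_moves_def verts_hexagon)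
  then show ?thesis by (simp add: game_chromatic_number_def verts_hexagon)
qed

lemma game_chromatic_number_hexagon_del_vert:
  assumes "x \<in> verts hexagon"
  shows "game_chromatic_number r (pre_digraph.del_vert hexagon x) \<le> 2"
proof -
  let ?H = "pre_digraph.del_vert hexagon x"
  note simps = legal_moves_def verts_hexagon arcs_ends_hexagon dominates_del_vert pre_digraph.verts_del_vert
  have fin: "finite (verts ?H)" by (simp add: simps)
  have "further_rounds ?H r Alice (verts ?H) {} \<le> 1"
  proof (cases "x < 6")
    case True
    \<comment> \<open>The middle of the path left by deleting \<open>x\<close>. It blocks its two
      neighbors, which are not adjacent; the ends of the path and the isolated vertices stay legal
      and are independent, so the round is forced.\<close>
    let ?c = "(x + 3) mod 6"
    have x: "x \<in> {0, 1, 2, 3, 4, 5}" using True by auto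
    show ?thesis
    proof (rule further_rounds_Alice_le[OF fin])
      show "?c \<in> legal_moves ?H (verts ?H) {}"
        using x by (elim insertE emptyE) (auto simp: simps)
      let ?U = "verts ?H - {?c}"
      have L: "legal_moves ?H ?U {?c} = {(x + 1) mod 6, (x + 5) mod 6, 6, 7}"
        using x by (elim insertE emptyE) (auto simp: simps)
      have B: "?U - {(x + 1) mod 6, (x + 5) mod 6, 6, 7} = {(x + 2) mod 6, (x + 4) mod 6}"
        using x by (elim insertE emptyE) (auto simp: simps)
      show "further_rounds ?H r Bob ?U {?c} \<le> 1"
      proof (rule further_rounds_le_one, unfold L B)
        show "\<not> a \<rightarrow>\<^bsub>?H\<^esub> b" if "a \<in> {(x + 1) mod 6, (x + 5) mod 6, 6, 7}"
          "b \<in> {(x + 1) mod 6, (x + 5) mod 6, 6, 7}" for a b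
          using x that by (elim insertE emptyE; simp add: simps)
        show "\<not> a \<rightarrow>\<^bsub>?H\<^esub> b" if "a \<in> {(x + 2) mod 6, (x + 4) mod 6}"
          "b \<in> {(x + 2) mod 6, (x + 4) mod 6}" for a b
          using x that by (elim insertE emptyE; simp add: simps)
      qed (use fin in simp)
    qed
  next
    case False
    \<comment> \<open>The surviving isolated vertex: by taking it, Alice leaves Bob to move on an
      untouched cycle.\<close>
    then obtain y :: nat where x: "x = 6 \<and> y = 7 \<or> x = 7 \<and> y = 6"
      using assms by (auto simp: simps)
    show ?thesis
    proof (rule further_rounds_Alice_le[OF fin])
      show "y \<in> legal_moves ?H (verts ?H) {}"
        using x by (auto simp: simps)
      show "further_rounds ?H r Bob (verts ?H - {y}) {y} \<le> 1"
      proof (rule further_rounds_le)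
        have "0 \<in> legal_moves ?H (verts ?H - {y}) {y}"
          using x by (elim disjE conjE) (simp_all add: simps)
        then show "legal_moves ?H (verts ?H - {y}) {y} \<noteq> {}"
          by blast
      next
        fix v assume v': "v \<in> legal_moves ?H (verts ?H - {y}) {y}"
        with x have v: "v \<in> {0, 1, 2, 3, 4, 5}" by (auto simp: simps)
        \<comment> \<open>Coloring \<open>v\<close> and \<open>?w\<close> blocks all three cycle
          vertices at odd distance from \<open>v\<close>. Only \<open>(v + 4) mod 6\<close> stays
          legal, so the round ends with the three blocked, pairwise nonadjacent vertices
          uncolored.\<close>
        let ?w = "(v + 2) mod 6"
        let ?U = "verts ?H - {y} - {v} - {?w}" and ?C = "{?w, v, y}"
        have U: "?U = {(v + 1) mod 6, (v + 3) mod 6, (v + 4) mod 6, (v + 5) mod 6}"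
          using x v by (elim insertE emptyE disjE conjE) (auto simp: simps)
        have L: "legal_moves ?H {(v + 1) mod 6, (v + 3) mod 6, (v + 4) mod 6, (v + 5) mod 6} ?C
            = {(v + 4) mod 6}"
          using x v by (elim insertE emptyE disjE conjE) (auto simp: simps)
        have B: "{(v + 1) mod 6, (v + 3) mod 6, (v + 4) mod 6, (v + 5) mod 6} - {(v + 4) mod 6}
            = {(v + 1) mod 6, (v + 3) mod 6, (v + 5) mod 6}"
          using v by (elim insertE emptyE) auto
        have "further_rounds ?H r Bob ?U ?C \<le> 1"
        proof (unfold U, rule further_rounds_le_one, unfold L B)
          show "\<not> a \<rightarrow>\<^bsub>?H\<^esub> b" if "a \<in> {(v + 4) mod 6}" "b \<in> {(v + 4) mod 6}" for a b
            using v that by (elim insertE emptyE; simp add: simps)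
          show "\<not> a \<rightarrow>\<^bsub>?H\<^esub> b" if "a \<in> {(v + 1) mod 6, (v + 3) mod 6, (v + 5) mod 6}"
            "b \<in> {(v + 1) mod 6, (v + 3) mod 6, (v + 5) mod 6}" for a b
            using v that by (elim insertE emptyE; simp add: simps)
        qed simp
        moreover have "?w \<in> legal_moves ?H (verts ?H - {y} - {v}) {v, y}"
          using x v by (elim insertE emptyE disjE conjE) (auto simp: simps)
        moreover have "finite (verts ?H - {y} - {v})"
          using fin by simp
        ultimately show
          "further_rounds ?H r (opponent Bob) (verts ?H - {y} - {v}) (insert v {y}) \<le> 1"
          unfolding opponent.simps by (intro further_rounds_Alice_le[where v = ?w])
      qed (use fin in simp)
    qed
  qed
  then show ?thesis by (simp add: game_chromatic_number_def)
qed

text \<open>The strategies concern the first round only, and what follows is bounded whoever starts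
  the later rounds. Hence \<open>r\<close> is arbitrary, and one graph serves both games.\<close>

lemma game_vertex_critical_hexagon: "game_vertex_critical 3 (game_chromatic_number r) hexagon"
proof -
  have "game_chromatic_number r hexagon = 3"
    using game_chromatic_number_hexagon_le game_chromatic_number_hexagon_ge by (rule antisym)
  moreover have "game_chromatic_number r (pre_digraph.del_vert hexagon x) \<noteq> 3"
    if "x \<in> verts hexagon" for x
    using game_chromatic_number_hexagon_del_vert[OF that, of r] by simp
  ultimately show ?thesis by (simp add: game_vertex_critical_def)
qed

theorem proposition17:
  shows "(\<exists>G :: (nat, nat \<times> nat) pre_digraph.
            graph G \<and> \<not> connected G \<and> game_vertex_critical 3 chi_ig_A G) \<and>
         (\<exists>G :: (nat, nat \<times> nat) pre_digraph.
            graph G \<and> \<not> connected G \<and> game_vertex_critical 3 chi_ig_AB G)"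
  unfolding chi_ig_A_def chi_ig_AB_def
  using graph_hexagon not_connected_hexagon game_vertex_critical_hexagon by blast

end
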